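(* Suppose that $p>3$ is a prime number and $n>0$ is an integer. An irreducible complex representation $\rho$ of $\mathrm{SL}_2(\mathbb{Z}/p^n)$ occurs in $\mathcal{O}(\mathrm{SL}_2(\mathbb{Z}/p^n))^{\mathrm{conj}}\otimes\mathbb{C}$ if and only if $\rho(-\mathrm{id})=1$ (i.e. $-\mathrm{id}$ acts trivially).
   Context: For a finite group $G$, $\mathcal{O}(G)^{\mathrm{conj}}\otimes\mathbb{C}$ is the space of all functions $G\to\mathbb{C}$, regarded as a representation of $G$ via conjugation, $(gF)(h)=F(g^{-1}hg)$. Equivalently, it is the group algebra $\mathbb{C}[G]$ with the conjugation action. *)

theory Defs
  imports
    Complex_Main
    "HOL-Library.Function_Algebras"
    "HOL-Algebra.Group_Action"
    "HOL-Number_Theory.Residues"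
begin

section \<open>The group \<open>SL\<^sub>2(R)\<close>\<close>

text \<open>The tuple \<open>(a, b, c, d)\<close> stands for the matrix with rows \<open>(a, b)\<close> and \<open>(c, d)\<close>.\<close>

definition SL2 :: "('a, 'm) ring_scheme \<Rightarrow> ('a \<times> 'a \<times> 'a \<times> 'a) monoid" where
  "SL2 R =
    \<lparr>carrier = {(a, b, c, d). a \<in> carrier R \<and> b \<in> carrier R \<and> c \<in> carrier R \<and> d \<in> carrier R \<and>
                  a \<otimes>\<^bsub>R\<^esub> d \<ominus>\<^bsub>R\<^esub> b \<otimes>\<^bsub>R\<^esub> c = \<one>\<^bsub>R\<^esub>},
     monoid.mult = (\<lambda>(a, b, c, d) (a', b', c', d').
       (a \<otimes>\<^bsub>R\<^esub> a' \<oplus>\<^bsub>R\<^esub> b \<otimes>\<^bsub>R\<^esub> c', a \<otimes>\<^bsub>R\<^esub> b' \<oplus>\<^bsub>R\<^esub> b \<otimes>\<^bsub>R\<^esub> d',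
        c \<otimes>\<^bsub>R\<^esub> a' \<oplus>\<^bsub>R\<^esub> d \<otimes>\<^bsub>R\<^esub> c', c \<otimes>\<^bsub>R\<^esub> b' \<oplus>\<^bsub>R\<^esub> d \<otimes>\<^bsub>R\<^esub> d')),
     one = (\<one>\<^bsub>R\<^esub>, \<zero>\<^bsub>R\<^esub>, \<zero>\<^bsub>R\<^esub>, \<one>\<^bsub>R\<^esub>)\<rparr>"

definition SL2_neg_id :: "('a, 'm) ring_scheme \<Rightarrow> 'a \<times> 'a \<times> 'a \<times> 'a" where
  "SL2_neg_id R = (\<ominus>\<^bsub>R\<^esub> \<one>\<^bsub>R\<^esub>, \<zero>\<^bsub>R\<^esub>, \<zero>\<^bsub>R\<^esub>, \<ominus>\<^bsub>R\<^esub> \<one>\<^bsub>R\<^esub>)"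

lemma (in cring) group_SL2: "group (SL2 R)"
proof (rule groupI)
  fix x y assume "x \<in> carrier (SL2 R)" "y \<in> carrier (SL2 R)"
  then obtain a b c d a' b' c' d' where xy: "x = (a, b, c, d)" "y = (a', b', c', d')"
    and c: "a \<in> carrier R" "b \<in> carrier R" "c \<in> carrier R" "d \<in> carrier R"
      "a' \<in> carrier R" "b' \<in> carrier R" "c' \<in> carrier R" "d' \<in> carrier R"
    and det: "a \<otimes> d \<ominus> b \<otimes> c = \<one>" "a' \<otimes> d' \<ominus> b' \<otimes> c' = \<one>"
    by (auto simp: SL2_def)
  have "(a \<otimes> a' \<oplus> b \<otimes> c') \<otimes> (c \<otimes> b' \<oplus> d \<otimes> d') \<ominus> (a \<otimes> b' \<oplus> b \<otimes> d') \<otimes> (c \<otimes> a' \<oplus> d \<otimes> c')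
      = (a \<otimes> d \<ominus> b \<otimes> c) \<otimes> (a' \<otimes> d' \<ominus> b' \<otimes> c')"
    using c by algebra
  then show "x \<otimes>\<^bsub>SL2 R\<^esub> y \<in> carrier (SL2 R)"
    using c det by (simp add: xy SL2_def)
next
  show "\<one>\<^bsub>SL2 R\<^esub> \<in> carrier (SL2 R)"
    by (simp add: SL2_def a_minus_def)
next
  fix x y z assume "x \<in> carrier (SL2 R)" "y \<in> carrier (SL2 R)" "z \<in> carrier (SL2 R)"
  then show "x \<otimes>\<^bsub>SL2 R\<^esub> y \<otimes>\<^bsub>SL2 R\<^esub> z = x \<otimes>\<^bsub>SL2 R\<^esub> (y \<otimes>\<^bsub>SL2 R\<^esub> z)"
    by (auto simp: SL2_def l_distr r_distr m_assoc a_ac)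
next
  fix x assume "x \<in> carrier (SL2 R)"
  then show "\<one>\<^bsub>SL2 R\<^esub> \<otimes>\<^bsub>SL2 R\<^esub> x = x"
    by (auto simp: SL2_def)
next
  fix x assume "x \<in> carrier (SL2 R)"
  then obtain a b c d where x: "x = (a, b, c, d)"
    and c: "a \<in> carrier R" "b \<in> carrier R" "c \<in> carrier R" "d \<in> carrier R"
    and det: "a \<otimes> d \<ominus> b \<otimes> c = \<one>"
    by (auto simp: SL2_def)
  have "d \<otimes> a \<ominus> \<ominus> b \<otimes> \<ominus> c = a \<otimes> d \<ominus> b \<otimes> c" "d \<otimes> a \<oplus> \<ominus> b \<otimes> c = a \<otimes> d \<ominus> b \<otimes> c"
    "\<ominus> c \<otimes> b \<oplus> a \<otimes> d = a \<otimes> d \<ominus> b \<otimes> c" "d \<otimes> b \<oplus> \<ominus> b \<otimes> d = \<zero>" "\<ominus> c \<otimes> a \<oplus> a \<otimes> c = \<zero>"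
    using c by algebra+
  then show "\<exists>y\<in>carrier (SL2 R). y \<otimes>\<^bsub>SL2 R\<^esub> x = \<one>\<^bsub>SL2 R\<^esub>"
    using c det by (intro bexI[of _ "(d, \<ominus> b, \<ominus> c, a)"]) (simp_all add: x SL2_def)
qed

section \<open>Complex representations\<close>

text \<open>
  The representation space is a subspace \<open>V\<close> of an ambient complex vector space (possibly all of
  it). No finite-dimensionality is imposed; for irreducible representations of finite groups it is
  automatic. By the convention of \<^locale>\<open>group_action\<close>, each \<open>\<rho> g\<close> is
  \<^const>\<open>undefined\<close> outside \<open>V\<close>.
\<close>

locale group_representation =
  vector_space scale + group_action G V \<rho>
  for G (structure) and scale :: "complex \<Rightarrow> 'v \<Rightarrow> 'v::ab_group_add" and V and \<rho> +
  assumes subspace_V: "subspace V"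
    and rho_add: "\<lbrakk>g \<in> carrier G; v \<in> V; w \<in> V\<rbrakk> \<Longrightarrow> \<rho> g (v + w) = \<rho> g v + \<rho> g w"
    and rho_scale: "\<lbrakk>g \<in> carrier G; v \<in> V\<rbrakk> \<Longrightarrow> \<rho> g (scale c v) = scale c (\<rho> g v)"
begin

definition invariant_subspace :: "'v set \<Rightarrow> bool" where
  "invariant_subspace W \<longleftrightarrow> subspace W \<and> W \<subseteq> V \<and> (\<forall>g\<in>carrier G. \<rho> g ` W \<subseteq> W)"

end

locale irreducible_representation = group_representation +
  assumes nonzero: "V \<noteq> {0}"
    and irreducible: "invariant_subspace W \<Longrightarrow> W = {0} \<or> W = V"

text \<open>\<open>\<rho>\<close> occurs in \<open>\<sigma>\<close> if it is isomorphic to a subrepresentation of \<open>\<sigma>\<close>.\<close>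

definition occurs_in ::
  "('g, 'm) monoid_scheme \<Rightarrow>
   (complex \<Rightarrow> 'v \<Rightarrow> 'v::ab_group_add) \<Rightarrow> 'v set \<Rightarrow> ('g \<Rightarrow> 'v \<Rightarrow> 'v) \<Rightarrow>
   (complex \<Rightarrow> 'w \<Rightarrow> 'w::ab_group_add) \<Rightarrow> 'w set \<Rightarrow> ('g \<Rightarrow> 'w \<Rightarrow> 'w) \<Rightarrow> bool" where
  "occurs_in G scale V \<rho> scale' U \<sigma> \<longleftrightarrow>
     (\<exists>W T. group_representation.invariant_subspace G scale' U \<sigma> W \<and> bij_betw T V W \<and>
       (\<forall>v\<in>V. \<forall>w\<in>V. T (v + w) = T v + T w) \<and>
       (\<forall>c. \<forall>v\<in>V. T (scale c v) = scale' c (T v)) \<and>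
       (\<forall>g\<in>carrier G. \<forall>v\<in>V. T (\<rho> g v) = \<sigma> g (T v)))"

section \<open>The conjugation representation on functions\<close>

text \<open>
  Functions on the group are represented by functions on the underlying type that vanish outside
  the carrier.
\<close>

definition functions_on :: "('g, 'm) monoid_scheme \<Rightarrow> ('g \<Rightarrow> complex) set" where
  "functions_on G = {F. \<forall>h. h \<notin> carrier G \<longrightarrow> F h = 0}"

definition fun_scale :: "complex \<Rightarrow> ('g \<Rightarrow> complex) \<Rightarrow> 'g \<Rightarrow> complex" where
  "fun_scale c F = (\<lambda>h. c * F h)"

definition conj_action ::
  "('g, 'm) monoid_scheme \<Rightarrow> 'g \<Rightarrow> ('g \<Rightarrow> complex) \<Rightarrow> 'g \<Rightarrow> complex" where
  "conj_action G g = (\<lambda>F\<in>functions_on G. \<lambda>h.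
     if h \<in> carrier G then F (inv\<^bsub>G\<^esub> g \<otimes>\<^bsub>G\<^esub> h \<otimes>\<^bsub>G\<^esub> g) else 0)"

lemma (in group) conj_representation:
  "group_representation G fun_scale (functions_on G) (conj_action G)"
proof -
  interpret F: vector_space "fun_scale :: complex \<Rightarrow> ('a \<Rightarrow> complex) \<Rightarrow> _"
    by standard (auto simp: fun_scale_def fun_eq_iff algebra_simps)
  have closed: "conj_action G g F \<in> functions_on G" if "F \<in> functions_on G" for g F
    using that by (auto simp: conj_action_def functions_on_def)
  have mult: "conj_action G (g \<otimes> h) F = conj_action G g (conj_action G h F)"
    if "g \<in> carrier G" "h \<in> carrier G" "F \<in> functions_on G" for g h F
    using that closed[OF that(3), of h]
    by (auto simp: conj_action_def fun_eq_iff inv_mult_group m_assoc)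
  have one: "conj_action G \<one> F = F" if "F \<in> functions_on G" for F
    using that by (auto simp: conj_action_def functions_on_def fun_eq_iff)
  have bij: "conj_action G g \<in> Bij (functions_on G)" if g: "g \<in> carrier G" for g
  proof -
    have "bij_betw (conj_action G g) (functions_on G) (functions_on G)"
      by (rule bij_betw_byWitness[where f' = "conj_action G (inv g)"])
        (use g closed in \<open>auto simp: mult[symmetric] one\<close>)
    then show ?thesis
      by (simp add: Bij_def conj_action_def)
  qed
  have "conj_action G \<in> hom G (BijGroup (functions_on G))"
  proof (rule homI)
    fix g h assume gh: "g \<in> carrier G" "h \<in> carrier G"
    have "conj_action G (g \<otimes> h) = compose (functions_on G) (conj_action G g) (conj_action G h)"
    proof (rule extensionalityI)
      show "conj_action G (g \<otimes> h) \<in> extensional (functions_on G)"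
        by (simp add: conj_action_def)
      show "compose (functions_on G) (conj_action G g) (conj_action G h)
          \<in> extensional (functions_on G)"
        by (rule compose_extensional)
    qed (use gh in \<open>simp add: mult compose_eq\<close>)
    then show "conj_action G (g \<otimes> h) =
        conj_action G g \<otimes>\<^bsub>BijGroup (functions_on G)\<^esub> conj_action G h"
      using gh by (simp add: BijGroup_def bij)
  qed (simp add: BijGroup_def bij)
  then have "group_hom G (BijGroup (functions_on G)) (conj_action G)"
    by (intro group_hom.intro group_hom_axioms.intro group_BijGroup is_group)
  moreover have "F.subspace (functions_on G)"
    by (auto simp: F.subspace_def functions_on_def fun_scale_def)
  ultimately show ?thesis
    by (intro group_representation.intro group_representation_axioms.intro group_action.intro
        F.vector_space_axioms)
      (auto simp: conj_action_def functions_on_def fun_scale_def fun_eq_iff)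
qed

end

theory Submission
  imports Defs
begin

text \<open>
  By Frobenius reciprocity, \<open>\<rho>\<close> occurs in the conjugation representation as soon as some
  centralizer \<open>Z(h)\<close> has a nonzero fixed vector in \<open>V\<close>. For \<open>h = diag(2, 1/2)\<close> the
  centralizer is the diagonal torus, since \<open>6\<close> is invertible. To find a torus-fixed vector, let
  \<open>M\<close> be minimal such that all \<open>(1, p\<^sup>M k; 0, 1)\<close> act trivially; then so do all
  diagonal matrices congruent to \<open>1\<close> modulo \<open>p\<^sup>M\<close>. If \<open>M = 0\<close>, the whole torus acts
  trivially. If \<open>M > 0\<close>, minimality provides an eigenvector \<open>w\<close> of the upper unipotent group
  whose character has exact order \<open>p\<^sup>M\<close>. The torus element \<open>diag(a, 1/a)\<close> rescales that
  character by \<open>a\<^sup>2\<close> or its inverse, so it fixes the character only if \<open>a \<equiv> \<plusminus>1\<close>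
  modulo \<open>p\<^sup>M\<close>, in which case it acts trivially because \<open>-1\<close> does. Hence the sum of the
  torus translates of \<open>w\<close> has a positive multiple of \<open>w\<close> as its component in the eigenspace of
  \<open>w\<close>, and is nonzero.
\<close>

section \<open>Linear functionals and representations of a group\<close>

text \<open>Extend \<open>{f}\<close> to a basis and take the coordinate along \<open>f\<close>;
  this works in any dimension.\<close>

lemma (in vector_space) exists_functional:
  assumes "f \<noteq> 0"
  obtains \<phi> where "\<And>v w. \<phi> (v + w) = \<phi> v + \<phi> w" "\<And>c v. \<phi> (scale c v) = c * \<phi> v" "\<phi> f = 1"
proof -
  let ?B = "extend_basis {f}"
  have f: "independent {f}"
    using assms by simp
  note B = independent_extend_basis[OF f] and span = span_extend_basis[OF f]
  have "f \<in> ?B"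
    using extend_basis_superset[OF f] by simp
  show thesis
    by (rule that[of "\<lambda>v. representation ?B v f"])
      (use B span \<open>f \<in> ?B\<close> in \<open>simp_all add: representation_add representation_scale representation_basis\<close>)
qed

context group_representation
begin

sublocale group G
  using group_hom by (rule group_hom.axioms(1))

lemma rho_in_V: "\<lbrakk>g \<in> carrier G; v \<in> V\<rbrakk> \<Longrightarrow> \<rho> g v \<in> V"
  using element_image by blast

lemma rho_one: "v \<in> V \<Longrightarrow> \<rho> \<one> v = v"
  by (metis id_eq_one restrict_apply')

lemma rho_inv_rho: "\<lbrakk>g \<in> carrier G; v \<in> V\<rbrakk> \<Longrightarrow> \<rho> (inv g) (\<rho> g v) = v"
  by (metis inv_closed composition_rule l_inv rho_one)

lemma rho_zero: "g \<in> carrier G \<Longrightarrow> \<rho> g 0 = 0"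
  using rho_scale[of g 0 0] subspace_0[OF subspace_V] by simp

lemma rho_sum:
  assumes "g \<in> carrier G" "\<And>i. i \<in> I \<Longrightarrow> f i \<in> V"
  shows "\<rho> g (\<Sum>i\<in>I. f i) = (\<Sum>i\<in>I. \<rho> g (f i))"
  using assms(2)
proof (induction I rule: infinite_finite_induct)
  case (insert i I)
  then show ?case
    using rho_add[OF assms(1), of "f i" "sum f I"] subspace_sum[OF subspace_V, of I f] by simp
qed (simp_all add: rho_zero assms(1))

definition acts_trivially :: "'a \<Rightarrow> bool" where
  "acts_trivially g \<longleftrightarrow> (\<forall>v\<in>V. \<rho> g v = v)"

lemma acts_trivially_mult:
  "\<lbrakk>g \<in> carrier G; h \<in> carrier G; acts_trivially g; acts_trivially h\<rbrakk> \<Longrightarrow> acts_trivially (g \<otimes> h)"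
  by (simp add: acts_trivially_def composition_rule)

lemma acts_trivially_conj:
  assumes "g \<in> carrier G" "h \<in> carrier G" "acts_trivially g"
  shows "acts_trivially (h \<otimes> g \<otimes> inv h)"
  using assms rho_inv_rho[of "inv h"] by (simp add: acts_trivially_def composition_rule rho_in_V)

text \<open>Left multiplication by \<open>h\<close> permutes \<open>H\<close> and hence the
  summands.\<close>

lemma sum_over_subgroup_fixed:
  assumes H: "subgroup H G" and h: "h \<in> H" and v: "v \<in> V"
  shows "\<rho> h (\<Sum>k\<in>H. \<rho> k v) = (\<Sum>k\<in>H. \<rho> k v)"
proof -
  have sub: "H \<subseteq> carrier G"
    using H by (rule subgroup.subset)
  have "\<rho> h (\<Sum>k\<in>H. \<rho> k v) = (\<Sum>k\<in>H. \<rho> (h \<otimes> k) v)"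
    using sub h v by (subst rho_sum) (auto simp: rho_in_V composition_rule subset_iff intro!: sum.cong)
  also have "\<dots> = (\<Sum>k\<in>H. \<rho> k v)"
    by (rule sum.reindex_bij_witness[where i = "\<lambda>k. inv h \<otimes> k" and j = "\<lambda>k. h \<otimes> k"])
      (use sub h subgroup.m_closed[OF H] subgroup.m_inv_closed[OF H] in
        \<open>auto simp: m_assoc[symmetric] subset_iff\<close>)
  finally show ?thesis .
qed

end

section \<open>Occurrence in the conjugation representation\<close>

text \<open>Conjugation by a central element is the identity, so \<open>z\<close> fixes
  \<open>T v\<close>; injectivity of \<open>T\<close> carries this back to \<open>v\<close>. Applied
  to the negative identity, it gives the forward direction of the theorem.\<close>

lemma (in group) central_acts_trivially_if_occurs:
  assumes "group_representation G scale V \<rho>"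
    and "occurs_in G scale V \<rho> fun_scale (functions_on G) (conj_action G)"
    and z: "z \<in> carrier G" "\<And>g. g \<in> carrier G \<Longrightarrow> z \<otimes> g = g \<otimes> z"
    and v: "v \<in> V"
  shows "\<rho> z v = v"
proof -
  interpret group_representation G scale V \<rho> by fact
  interpret C: group_representation G fun_scale "functions_on G" "conj_action G"
    by (rule conj_representation)
  obtain W T where W: "C.invariant_subspace W" and T: "bij_betw T V W"
    and eq: "\<And>g v. \<lbrakk>g \<in> carrier G; v \<in> V\<rbrakk> \<Longrightarrow> T (\<rho> g v) = conj_action G g (T v)"
    using assms(2) unfolding occurs_in_def by blast
  have F: "T v \<in> functions_on G"
    using W T v by (auto simp: C.invariant_subspace_def bij_betw_def)
  have "inv z \<otimes> h \<otimes> z = h" if "h \<in> carrier G" for h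
    using z that by (metis inv_closed m_assoc l_inv l_one)
  then have "conj_action G z (T v) = T v"
    using F z by (auto simp: conj_action_def functions_on_def fun_eq_iff)
  then show ?thesis
    using T eq v z rho_in_V by (metis bij_betw_def inj_onD)
qed

text \<open>This is Frobenius reciprocity for the permutation representation on the conjugacy class of
  \<open>h\<close>: the embedding sends \<open>v\<close> to \<open>x \<mapsto> \<Sum>\<^sub>k \<phi> (k\<^sup>-\<^sup>1 v)\<close>, where \<open>k\<close>
  ranges over the elements with \<open>k h k\<^sup>-\<^sup>1 = x\<close>.\<close>

lemma (in group) occurs_if_centralizer_fixes:
  assumes "irreducible_representation G scale V \<rho>"
    and fin: "finite (carrier G)"
    and h: "h \<in> carrier G"
    and f: "f \<in> V" "f \<noteq> 0"
    and fix_f: "\<And>k. \<lbrakk>k \<in> carrier G; k \<otimes> h = h \<otimes> k\<rbrakk> \<Longrightarrow> \<rho> k f = f"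
  shows "occurs_in G scale V \<rho> fun_scale (functions_on G) (conj_action G)"
proof -
  interpret irreducible_representation G scale V \<rho> by fact
  interpret C: group_representation G fun_scale "functions_on G" "conj_action G"
    by (rule conj_representation)
  obtain \<phi> where \<phi>: "\<And>v w. \<phi> (v + w) = \<phi> v + \<phi> w" "\<And>c v. \<phi> (scale c v) = c * \<phi> v" "\<phi> f = 1"
    using exists_functional[OF f(2)] by blast
  define K where "K x = {k \<in> carrier G. k \<otimes> h \<otimes> inv k = x}" for x
  define T where "T v x = (\<Sum>k\<in>K x. \<phi> (\<rho> (inv k) v))" for v x
  have T_fun: "T v \<in> functions_on G" for v
  proof -
    have "K x = {}" if "x \<notin> carrier G" for x
      using that h by (auto simp: K_def)
    then show ?thesis
      by (simp add: functions_on_def T_def)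
  qed
  have T_add: "T (v + w) = T v + T w" if "v \<in> V" "w \<in> V" for v w
    using that
    by (auto simp: fun_eq_iff T_def K_def rho_add \<phi> sum.distrib[symmetric] intro!: sum.cong)
  have T_scale: "T (scale c v) = fun_scale c (T v)" if "v \<in> V" for c v
    using that
    by (auto simp: fun_eq_iff T_def K_def rho_scale \<phi> fun_scale_def sum_distrib_left
        intro!: sum.cong)
  have T_act: "T (\<rho> g v) = conj_action G g (T v)" if g: "g \<in> carrier G" and v: "v \<in> V" for g v
  proof
    fix x
    show "T (\<rho> g v) x = conj_action G g (T v) x"
    proof (cases "x \<in> carrier G")
      case True
      \<comment> \<open>Left multiplication by \<open>inv g\<close> is a bijection from
        \<open>K x\<close> onto \<open>K (inv g \<otimes> x \<otimes> g)\<close> that matches the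
        summands.\<close>
      have "T (\<rho> g v) x = T v (inv g \<otimes> x \<otimes> g)"
        unfolding T_def
      proof (rule sum.reindex_bij_witness[where i = "\<lambda>k. g \<otimes> k" and j = "\<lambda>k. inv g \<otimes> k"])
        fix k assume k: "k \<in> K x"
        then have kc: "k \<in> carrier G" and x: "x = k \<otimes> h \<otimes> inv k"
          by (auto simp: K_def)
        show "g \<otimes> (inv g \<otimes> k) = k"
          using g kc by (simp add: m_assoc[symmetric])
        show "inv g \<otimes> k \<in> K (inv g \<otimes> x \<otimes> g)"
          using g kc h by (simp add: K_def x inv_mult_group m_assoc)
        show "\<phi> (\<rho> (inv (inv g \<otimes> k)) v) = \<phi> (\<rho> (inv k) (\<rho> g v))"
          using g kc v by (simp add: inv_mult_group composition_rule)
      next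
        fix k assume k: "k \<in> K (inv g \<otimes> x \<otimes> g)"
        then have kc: "k \<in> carrier G" and x: "k \<otimes> h \<otimes> inv k = inv g \<otimes> x \<otimes> g"
          by (auto simp: K_def)
        show "inv g \<otimes> (g \<otimes> k) = k"
          using g kc by (simp add: m_assoc[symmetric])
        have "g \<otimes> k \<otimes> h \<otimes> inv (g \<otimes> k) = g \<otimes> (k \<otimes> h \<otimes> inv k) \<otimes> inv g"
          using g kc h by (simp add: inv_mult_group m_assoc)
        also have "\<dots> = (g \<otimes> inv g) \<otimes> x \<otimes> (g \<otimes> inv g)"
          unfolding x using g True by (simp only: m_assoc m_closed inv_closed)
        also have "\<dots> = x"
          using g True by simp
        finally show "g \<otimes> k \<in> K x"
          using g kc by (simp add: K_def)
      qed
      then show ?thesis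
        using True T_fun by (simp add: conj_action_def)
    qed (use T_fun[of "\<rho> g v"] T_fun[of v] in \<open>simp add: conj_action_def functions_on_def\<close>)
  qed
  \<comment> \<open>\<open>K h\<close> is the centralizer of \<open>h\<close>. It fixes
    \<open>f\<close>, so every summand is \<open>\<phi> f = 1\<close> and the value is the order of
    the centralizer.\<close>
  have "T f h \<noteq> 0"
  proof -
    have "\<phi> (\<rho> (inv k) f) = 1" if "k \<in> K h" for k
    proof -
      from that have k: "k \<in> carrier G" "k \<otimes> h \<otimes> inv k = h"
        by (auto simp: K_def)
      then have "k \<otimes> h = h \<otimes> k"
        using h by (metis inv_solve_right' m_closed)
      then have "\<rho> k f = f"
        using k fix_f by simp
      then show ?thesis
        using rho_inv_rho[OF k(1) f(1)] \<phi> by simp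
    qed
    then have "T f h = of_nat (card (K h))"
      by (simp add: T_def)
    moreover have "\<one> \<in> K h" "finite (K h)"
      using h fin by (auto simp: K_def)
    ultimately show ?thesis
      by auto
  qed
  have T0: "T 0 = 0"
    using T_scale[OF subspace_0[OF subspace_V], of 0] by (simp add: fun_scale_def fun_eq_iff)
  \<comment> \<open>The kernel of \<open>T\<close> is invariant and misses \<open>f\<close>, so
    irreducibility makes it zero and \<open>T\<close> injective.\<close>
  define N where "N = {v \<in> V. T v = 0}"
  have "invariant_subspace N"
    unfolding invariant_subspace_def N_def
    using subspace_V rho_in_V
    by (auto simp: subspace_def T0 T_add T_scale T_act fun_scale_def fun_eq_iff conj_action_def
        functions_on_def)
  moreover have "f \<notin> N"
    using \<open>T f h \<noteq> 0\<close> by (auto simp: N_def)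
  ultimately have N: "N = {0}"
    using irreducible f by blast
  have inj: "inj_on T V"
  proof (rule inj_onI)
    fix v w assume vw: "v \<in> V" "w \<in> V" "T v = T w"
    have "T (v - w) = T v + fun_scale (- 1) (T w)"
      using T_add[of v "- w"] T_scale[of w "- 1"] vw subspace_V by (simp add: subspace_neg)
    then have "v - w \<in> N"
      using vw subspace_V by (auto simp: N_def subspace_diff fun_scale_def fun_eq_iff)
    then show "v = w"
      using N by simp
  qed
  have "C.invariant_subspace (T ` V)"
    unfolding C.invariant_subspace_def C.subspace_def
  proof (intro conjI ballI allI)
    show "0 \<in> T ` V"
      using T0 subspace_0[OF subspace_V] by force
    show "x + y \<in> T ` V" if "x \<in> T ` V" "y \<in> T ` V" for x y
      using that subspace_V by (auto simp: subspace_def T_add[symmetric])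
    show "fun_scale c x \<in> T ` V" if "x \<in> T ` V" for c x
      using that subspace_V by (auto simp: subspace_def T_scale[symmetric])
    show "conj_action G g ` T ` V \<subseteq> T ` V" if "g \<in> carrier G" for g
      using that rho_in_V by (auto simp: T_act[symmetric])
  qed (use T_fun in blast)
  moreover have "bij_betw T V (T ` V)"
    using inj by (simp add: bij_betw_def)
  ultimately show ?thesis
    unfolding occurs_in_def using T_add T_scale T_act by blast
qed

section \<open>Additive characters modulo m\<close>

text \<open>For \<open>m > 0\<close> this is the standard primitive additive character of the
  integers modulo \<open>m\<close>, taken on integers to avoid a quotient type; all others are
  \<open>x \<mapsto> unit_char m (x * y)\<close>.\<close>

definition unit_char :: "int \<Rightarrow> int \<Rightarrow> complex" where
  "unit_char m x = cis (2 * pi * (of_int x / of_int m))"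

lemma unit_char_add: "unit_char m (x + y) = unit_char m x * unit_char m y"
  by (simp add: unit_char_def cis_mult add_divide_distrib distrib_left)

lemma unit_char_0 [simp]: "unit_char m 0 = 1"
  by (simp add: unit_char_def)

lemma unit_char_eq_1_iff:
  assumes "m > 0"
  shows "unit_char m x = 1 \<longleftrightarrow> m dvd x"
proof
  assume "m dvd x"
  then obtain k where "x = m * k" ..
  then show "unit_char m x = 1"
    using assms by (simp add: unit_char_def)
next
  assume "unit_char m x = 1"
  then have "cos (2 * pi * (of_int x / of_int m)) = 1"
    by (simp add: unit_char_def complex_eq_iff)
  then obtain k :: int where "2 * pi * (of_int x / of_int m) = of_int k * 2 * pi"
    by (auto simp: cos_one_2pi_int)
  then have "of_int x = (of_int (k * m) :: real)"
    using assms by (simp add: field_simps)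
  then show "m dvd x"
    by (simp only: of_int_eq_iff dvd_triv_right)
qed

lemma unit_char_cong:
  assumes "m > 0" "[x = y] (mod m)"
  shows "unit_char m x = unit_char m y"
proof -
  have "unit_char m (x - y) = 1"
    using assms by (simp add: unit_char_eq_1_iff cong_iff_dvd_diff)
  then show ?thesis
    using unit_char_add[of m "x - y" y] by simp
qed

lemma sum_residues_shift:
  fixes m a :: int
  assumes "m > 0"
  shows "(\<Sum>x\<in>{0..<m}. f ((x + a) mod m)) = (\<Sum>x\<in>{0..<m}. f x)"
  by (rule sum.reindex_bij_witness[where i = "\<lambda>x. (x - a) mod m" and j = "\<lambda>x. (x + a) mod m"])
    (use assms in \<open>auto simp: mod_simps\<close>)

text \<open>Orthogonality of characters. Replacing \<open>x\<close> by \<open>x + 1\<close>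
  multiplies the sum by \<open>unit_char m y\<close>, which differs from 1 unless \<open>m\<close>
  divides \<open>y\<close>.\<close>

lemma sum_unit_char:
  assumes m: "m > 0"
  shows "(\<Sum>x\<in>{0..<m}. unit_char m (x * y)) = (if m dvd y then of_int m else 0)"
proof (cases "m dvd y")
  case True
  then have "unit_char m (x * y) = 1" for x
    using m by (simp add: unit_char_eq_1_iff)
  then show ?thesis
    using True m by simp
next
  case False
  let ?S = "\<Sum>x\<in>{0..<m}. unit_char m (x * y)"
  have "?S = (\<Sum>x\<in>{0..<m}. unit_char m (((x + 1) mod m) * y))"
    using sum_residues_shift[OF m, of "\<lambda>x. unit_char m (x * y)" 1] by simp
  also have "\<dots> = (\<Sum>x\<in>{0..<m}. unit_char m (x * y + y))"
    by (intro sum.cong refl unit_char_cong m) (simp add: cong_def mod_simps algebra_simps)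
  also have "\<dots> = ?S * unit_char m y"
    by (simp add: unit_char_add sum_distrib_right)
  finally have "?S = 0"
    using False m unit_char_eq_1_iff[of m y] by simp
  then show ?thesis
    using False by simp
qed

section \<open>Matrices modulo m and the diagonal torus\<close>

context residues
begin

text \<open>Reducing integer entries inside the definition turns matrix identities over the residue
  ring into integer congruences.\<close>

definition mat :: "int \<Rightarrow> int \<Rightarrow> int \<Rightarrow> int \<Rightarrow> int \<times> int \<times> int \<times> int" where
  "mat a b c d = (a mod m, b mod m, c mod m, d mod m)"

abbreviation upper :: "int \<Rightarrow> int \<times> int \<times> int \<times> int" where
  "upper x \<equiv> mat 1 x 0 1"

lemma mat_eq_iff:
  "mat a b c d = mat a' b' c' d' \<longleftrightarrow>
    [a = a'] (mod m) \<and> [b = b'] (mod m) \<and> [c = c'] (mod m) \<and> [d = d'] (mod m)"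
  by (simp add: mat_def cong_def)

lemma mat_in_SL2_iff: "mat a b c d \<in> carrier (SL2 R) \<longleftrightarrow> [a * d - b * c = 1] (mod m)"
proof -
  have "[a mod m * (d mod m) - b mod m * (c mod m) = a * d - b * c] (mod m)"
    by (intro cong_diff cong_mult) (simp_all add: cong_def)
  then show ?thesis
    using m_gt_one
    by (simp add: mat_def SL2_def res_carrier_eq res_mult_eq res_one_eq a_minus_def res_neg_eq
        res_add_eq cong_def mod_simps)
qed

lemma mat_in_SL2: "a * d - b * c = 1 \<Longrightarrow> mat a b c d \<in> carrier (SL2 R)"
  by (simp add: mat_in_SL2_iff)

lemma SL2_cases:
  assumes "g \<in> carrier (SL2 R)"
  obtains a b c d where "g = mat a b c d" "[a * d - b * c = 1] (mod m)"
proof -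
  obtain a b c d where g: "g = (a, b, c, d)"
    by (cases g)
  then have "g = mat a b c d"
    using assms by (auto simp: SL2_def res_carrier_eq mat_def)
  then show thesis
    using that assms mat_in_SL2_iff by blast
qed

lemma finite_SL2: "finite (carrier (SL2 R))"
  by (rule finite_subset[of _ "carrier R \<times> carrier R \<times> carrier R \<times> carrier R"])
    (auto simp: SL2_def res_carrier_eq)

lemma mat_mult:
  "mat a b c d \<otimes>\<^bsub>SL2 R\<^esub> mat a' b' c' d' =
    mat (a * a' + b * c') (a * b' + b * d') (c * a' + d * c') (c * b' + d * d')"
proof -
  have "[(x mod m) * (y mod m) + (z mod m) * (w mod m) = x * y + z * w] (mod m)" for x y z w
    by (intro cong_add cong_mult) simp_all
  then show ?thesis
    by (simp add: mat_def SL2_def res_mult_eq res_add_eq mod_simps cong_def)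
qed

lemma one_SL2: "\<one>\<^bsub>SL2 R\<^esub> = mat 1 0 0 1"
  using m_gt_one by (simp add: mat_def SL2_def res_one_eq res_zero_eq)

lemma SL2_neg_id: "SL2_neg_id R = mat (- 1) 0 0 (- 1)"
  using m_gt_one by (simp add: mat_def SL2_neg_id_def res_one_eq res_zero_eq res_neg_eq)

lemma mat_inv:
  assumes "[a * d - b * c = 1] (mod m)"
  shows "inv\<^bsub>SL2 R\<^esub> (mat a b c d) = mat d (- b) (- c) a"
proof (rule group.inv_equality[OF group_SL2])
  show "mat d (- b) (- c) a \<otimes>\<^bsub>SL2 R\<^esub> mat a b c d = \<one>\<^bsub>SL2 R\<^esub>"
    using assms by (simp add: mat_mult one_SL2 mat_eq_iff algebra_simps)
qed (use assms in \<open>simp_all add: mat_in_SL2_iff algebra_simps\<close>)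

lemma neg_id_central:
  "g \<in> carrier (SL2 R) \<Longrightarrow> SL2_neg_id R \<otimes>\<^bsub>SL2 R\<^esub> g = g \<otimes>\<^bsub>SL2 R\<^esub> SL2_neg_id R"
  by (elim SL2_cases) (simp add: SL2_neg_id mat_mult)

definition torus :: "(int \<times> int \<times> int \<times> int) set" where
  "torus = {mat a 0 0 b |a b. [a * b = 1] (mod m)}"

lemma subgroup_torus: "subgroup torus (SL2 R)"
proof (rule group.subgroupI[OF group_SL2])
  show "torus \<subseteq> carrier (SL2 R)"
    by (auto simp: torus_def mat_in_SL2_iff)
  have "mat 1 0 0 1 \<in> torus"
    unfolding torus_def by force
  then show "torus \<noteq> {}"
    by blast
next
  fix s assume "s \<in> torus"
  then obtain a b where s: "s = mat a 0 0 b" "[a * b = 1] (mod m)"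
    by (auto simp: torus_def)
  then have "inv\<^bsub>SL2 R\<^esub> s = mat b 0 0 a" "[b * a = 1] (mod m)"
    by (simp_all add: mat_inv mult.commute)
  then show "inv\<^bsub>SL2 R\<^esub> s \<in> torus"
    by (auto simp: torus_def)
next
  fix s t assume "s \<in> torus" "t \<in> torus"
  then obtain a b a' b' where s: "s = mat a 0 0 b" "[a * b = 1] (mod m)"
    and t: "t = mat a' 0 0 b'" "[a' * b' = 1] (mod m)"
    by (auto simp: torus_def)
  have "[(a * b) * (a' * b') = 1 * 1] (mod m)"
    by (rule cong_mult[OF s(2) t(2)])
  then have "[(a * a') * (b * b') = 1] (mod m)"
    by (simp add: ac_simps)
  then show "s \<otimes>\<^bsub>SL2 R\<^esub> t \<in> torus"
    by (auto simp: torus_def s t mat_mult)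
qed

text \<open>Comparing off-diagonal entries gives \<open>e * b = 2 * b\<close> and
  \<open>e * c = 2 * c\<close> modulo \<open>m\<close>. As \<open>2 * e = 1\<close>, twice
  \<open>2 - e\<close> is 3, a unit, so \<open>b\<close> and \<open>c\<close> vanish.\<close>

lemma centralizer_in_torus:
  assumes m: "coprime m 3" and e: "[2 * e = 1] (mod m)"
    and k: "k \<in> carrier (SL2 R)" and comm: "k \<otimes>\<^bsub>SL2 R\<^esub> mat 2 0 0 e = mat 2 0 0 e \<otimes>\<^bsub>SL2 R\<^esub> k"
  shows "k \<in> torus"
proof -
  obtain a b c d where kk: "k = mat a b c d" "[a * d - b * c = 1] (mod m)"
    using k by (rule SL2_cases)
  have zero: "[x = 0] (mod m)" if "[e * x = 2 * x] (mod m)" for x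
  proof -
    have "m dvd 2 * (2 * x - e * x) + x * (2 * e - 1)"
      using that e by (intro dvd_add dvd_mult) (simp_all add: cong_iff_dvd_diff dvd_diff_commute)
    also have "\<dots> = 3 * x"
      by (simp add: algebra_simps)
    finally show ?thesis
      using m by (simp add: coprime_dvd_mult_right_iff cong_0_iff)
  qed
  have "[e * b = 2 * b] (mod m)" "[e * c = 2 * c] (mod m)"
    using comm by (simp_all add: kk mat_mult mat_eq_iff mult.commute cong_sym)
  then have bc: "[b = 0] (mod m)" "[c = 0] (mod m)"
    by (auto intro: zero)
  then have "[a * d - b * c = a * d - 0 * 0] (mod m)"
    by (intro cong_diff cong_mult cong_refl)
  then have "[a * d = 1] (mod m)"
    using kk(2) by (simp add: cong_def)
  moreover have "k = mat a 0 0 d"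
    using bc by (simp add: kk mat_eq_iff)
  ultimately show ?thesis
    by (auto simp: torus_def)
qed

end

section \<open>Unipotent eigenvectors and the torus action\<close>

locale residues_SL2_representation = residues m R + rep: group_representation "SL2 R" scale V \<rho>
  for m :: int and R (structure) and scale :: "complex \<Rightarrow> 'v \<Rightarrow> 'v::ab_group_add"
    and V :: "'v set" and \<rho>
begin

text \<open>The diagonal matrix is a product of conjugates of the assumed trivially acting elements:
  with \<open>a = 1 + z q\<close> it is obtained from
  \<open>upper z \<cdot> lower q \<cdot> upper (- z)\<close> by clearing the off-diagonal entries.\<close>

lemma diagonal_acts_trivially:
  assumes q: "\<And>k. rep.acts_trivially (upper (k * q))"
    and ab: "[a * b = 1] (mod m)" and "q dvd a - 1"
  shows "rep.acts_trivially (mat a 0 0 b)"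
proof -
  obtain z where z: "a = 1 + q * z"
    using \<open>q dvd a - 1\<close> by (metis dvdE add.commute diff_add_cancel)
  obtain t where t: "a * b = 1 + m * t"
    using ab by (metis cong_iff_dvd_diff dvdE add.commute diff_add_cancel)
  \<comment> \<open>Conjugation by the Weyl element \<open>mat 0 (- 1) 1 0\<close> swaps the two
    unipotent subgroups and changes the sign of the entry.\<close>
  have lower: "rep.acts_trivially (mat 1 0 (k * q) 1)" for k
    using rep.acts_trivially_conj[OF _ _ q[of "- k"], of "mat 0 (- 1) 1 0"]
    by (simp add: mat_in_SL2 mat_mult mat_inv)
  have C: "rep.acts_trivially (mat a (- z * z * q) q (1 - z * q))"
    using rep.acts_trivially_conj[OF _ _ lower[of 1], of "upper z"]
    by (simp add: mat_in_SL2 mat_mult mat_inv z algebra_simps)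
  \<comment> \<open>Since \<open>b\<close> inverts \<open>a\<close>, the column operation with
    \<open>b * z * z * q\<close> cancels the upper right entry \<open>- z * z * q\<close>; the row
    operation with \<open>- b * q\<close> below cancels the lower left entry
    \<open>q\<close>.\<close>
  have "rep.acts_trivially (mat a (- z * z * q) q (1 - z * q) \<otimes>\<^bsub>SL2 R\<^esub> upper ((b * z * z) * q))"
    by (rule rep.acts_trivially_mult[OF _ _ C q]) (simp_all add: mat_in_SL2 z algebra_simps)
  then have "rep.acts_trivially (mat 1 0 ((- b) * q) 1 \<otimes>\<^bsub>SL2 R\<^esub>
      (mat a (- z * z * q) q (1 - z * q) \<otimes>\<^bsub>SL2 R\<^esub> upper ((b * z * z) * q)))"
    by (intro rep.acts_trivially_mult[OF _ _ lower] rep.m_closed)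
      (simp_all add: mat_in_SL2 z algebra_simps)
  also have "mat 1 0 ((- b) * q) 1 \<otimes>\<^bsub>SL2 R\<^esub>
      (mat a (- z * z * q) q (1 - z * q) \<otimes>\<^bsub>SL2 R\<^esub> upper ((b * z * z) * q)) = mat a 0 0 b"
    unfolding mat_mult mat_eq_iff
  proof (intro conjI)
    have "a * (b * z * z * q) + - z * z * q * 1 = (a * b - 1) * (z * z * q)"
      by (simp add: algebra_simps)
    then have B: "[a * (b * z * z * q) + - z * z * q * 1 = 0] (mod m)"
      by (simp add: t cong_0_iff)
    then show "[1 * (a * (b * z * z * q) + - z * z * q * 1) + 0 * (q * (b * z * z * q) + (1 - z * q) * 1) = 0] (mod m)"
      by simp
    have "- b * q * (a * 1 + - z * z * q * 0) + 1 * (q * 1 + (1 - z * q) * 0) = (1 - a * b) * q"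
      by (simp add: algebra_simps)
    then show "[- b * q * (a * 1 + - z * z * q * 0) + 1 * (q * 1 + (1 - z * q) * 0) = 0] (mod m)"
      by (simp add: t cong_0_iff)
    \<comment> \<open>Substituting \<open>z * q = a - 1\<close> turns the left side into
      \<open>b * (a - 1)^2 + 2 - a - b\<close>, which has the factor
      \<open>a * b - 1\<close>.\<close>
    have "q * (b * z * z * q) + (1 - z * q) * 1 - b = (a * b - 1) * (a - 2)"
      by (simp add: z algebra_simps)
    then have "[q * (b * z * z * q) + (1 - z * q) * 1 = b] (mod m)"
      by (simp add: t cong_iff_dvd_diff)
    moreover have "[- b * q * (a * (b * z * z * q) + - z * z * q * 1) = - b * q * 0] (mod m)"
      using B by (rule cong_scalar_left)
    ultimately have "[- b * q * (a * (b * z * z * q) + - z * z * q * 1) + (q * (b * z * z * q) + (1 - z * q) * 1) = - b * q * 0 + b] (mod m)"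
      by (intro cong_add)
    then show "[- b * q * (a * (b * z * z * q) + - z * z * q * 1) + 1 * (q * (b * z * z * q) + (1 - z * q) * 1) = b] (mod m)"
      by simp
  qed simp
  finally show ?thesis .
qed

text \<open>This is \<open>m\<close> times the projection to the vectors on which each
  \<open>upper x\<close> acts by \<open>unit_char m (x * y)\<close>; leaving out the factor
  \<open>1 / m\<close> avoids division.\<close>

definition eigen_component :: "int \<Rightarrow> 'v \<Rightarrow> 'v" where
  "eigen_component y v = (\<Sum>x\<in>{0..<m}. scale (unit_char m (- (x * y))) (\<rho> (upper x) v))"

lemma upper_in_SL2: "upper x \<in> carrier (SL2 R)"
  by (simp add: mat_in_SL2)

lemma eigen_component_in_V: "v \<in> V \<Longrightarrow> eigen_component y v \<in> V"
  unfolding eigen_component_def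
  by (intro rep.subspace_sum rep.subspace_scale rep.subspace_V rep.rho_in_V upper_in_SL2)

lemma rho_upper_eigen_component:
  assumes v: "v \<in> V"
  shows "\<rho> (upper a) (eigen_component y v) = scale (unit_char m (a * y)) (eigen_component y v)"
proof -
  have m: "m > 0"
    using m_gt_one by simp
  define F where "F x = scale (unit_char m (- (x * y))) (\<rho> (upper x) v)" for x
  \<comment> \<open>Periodicity lets the translation of the summation index by \<open>a\<close> be
    read modulo \<open>m\<close>.\<close>
  have F: "F (x mod m) = F x" for x
  proof -
    have "upper (x mod m) = upper x"
      by (simp add: mat_eq_iff)
    moreover have "unit_char m (- (x mod m * y)) = unit_char m (- (x * y))"
      by (intro unit_char_cong m cong_minus_minus_iff[THEN iffD2] cong_mult cong_refl)
        (simp add: cong_def)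
    ultimately show ?thesis
      by (simp add: F_def)
  qed
  have "\<rho> (upper a) (eigen_component y v) = (\<Sum>x\<in>{0..<m}. \<rho> (upper a) (F x))"
    unfolding eigen_component_def F_def
    by (intro rep.rho_sum rep.subspace_scale rep.subspace_V rep.rho_in_V upper_in_SL2 v)
  also have "\<dots> = (\<Sum>x\<in>{0..<m}. scale (unit_char m (a * y)) (F (x + a)))"
  proof (intro sum.cong refl)
    fix x
    have "\<rho> (upper a) (F x) = scale (unit_char m (- (x * y))) (\<rho> (upper a) (\<rho> (upper x) v))"
      unfolding F_def by (intro rep.rho_scale rep.rho_in_V upper_in_SL2 v)
    also have "\<rho> (upper a) (\<rho> (upper x) v) = \<rho> (upper (x + a)) v"
      using rep.composition_rule[OF v upper_in_SL2 upper_in_SL2, of a x]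
      by (simp add: mat_mult)
    also have "unit_char m (- (x * y)) = unit_char m (a * y) * unit_char m (- ((x + a) * y))"
      by (simp add: unit_char_add[symmetric] algebra_simps)
    finally show "\<rho> (upper a) (F x) = scale (unit_char m (a * y)) (F (x + a))"
      by (simp add: F_def)
  qed
  also have "\<dots> = scale (unit_char m (a * y)) (\<Sum>x\<in>{0..<m}. F ((x + a) mod m))"
    by (simp add: F rep.scale_sum_right)
  also have "\<dots> = scale (unit_char m (a * y)) (eigen_component y v)"
    unfolding sum_residues_shift[OF m] by (simp add: eigen_component_def F_def)
  finally show ?thesis .
qed

text \<open>Fourier inversion: summing over \<open>y\<close> first kills every term except
  \<open>x = 0\<close>.\<close>

lemma sum_eigen_components:
  assumes v: "v \<in> V"
  shows "(\<Sum>y\<in>{0..<m}. eigen_component y v) = scale (of_int m) v"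
proof -
  have m: "m > 0"
    using m_gt_one by simp
  have "(\<Sum>y\<in>{0..<m}. eigen_component y v)
      = (\<Sum>x\<in>{0..<m}. scale (\<Sum>y\<in>{0..<m}. unit_char m (y * (- x))) (\<rho> (upper x) v))"
    unfolding eigen_component_def
    by (subst sum.swap) (simp add: rep.scale_sum_left mult.commute)
  also have "\<dots> = (\<Sum>x\<in>{0..<m}. if x = 0 then scale (of_int m) v else 0)"
  proof (intro sum.cong refl)
    fix x assume "x \<in> {0..<m}"
    then have "m dvd - x \<longleftrightarrow> x = 0"
      using zdvd_not_zless[of x m] by (cases "x = 0") auto
    then show "scale (\<Sum>y\<in>{0..<m}. unit_char m (y * - x)) (\<rho> (upper x) v)
        = (if x = 0 then scale (of_int m) v else 0)"
      unfolding sum_unit_char[OF m] using rep.rho_one[OF v] by (auto simp: one_SL2)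
  qed
  also have "\<dots> = scale (of_int m) v"
    using m by simp
  finally show ?thesis .
qed

text \<open>If \<open>upper k\<close> fixed every eigencomponent of \<open>v\<close>, it would fix
  their sum \<open>m v\<close> and hence \<open>v\<close>. So some nonzero component has an
  eigenvalue other than 1 at \<open>k\<close>.\<close>

lemma exists_upper_eigenvector:
  assumes v: "v \<in> V" and k: "\<rho> (upper k) v \<noteq> v"
  obtains w y where "w \<in> V" "w \<noteq> 0" "\<And>a. \<rho> (upper a) w = scale (unit_char m (a * y)) w"
    "\<not> m dvd k * y"
proof -
  have m: "m > 0"
    using m_gt_one by simp
  have "\<exists>y. eigen_component y v \<noteq> 0 \<and> \<not> m dvd k * y"
  proof (rule ccontr)
    assume "\<not> ?thesis"
    then have "eigen_component y v = 0 \<or> unit_char m (k * y) = 1" for y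
      using m unit_char_eq_1_iff by blast
    then have *: "\<rho> (upper k) (eigen_component y v) = eigen_component y v" for y
      using v by (metis rho_upper_eigen_component rep.scale_one rep.scale_zero_right)
    have "scale (of_int m) (\<rho> (upper k) v) = \<rho> (upper k) (\<Sum>y\<in>{0..<m}. eigen_component y v)"
      by (simp add: sum_eigen_components v rep.rho_scale upper_in_SL2)
    also have "\<dots> = scale (of_int m) v"
      by (subst rep.rho_sum) (simp_all add: * v upper_in_SL2 eigen_component_in_V sum_eigen_components)
    finally show False
      using k m by simp
  qed
  then show thesis
    using that eigen_component_in_V[OF v] rho_upper_eigen_component[OF v] by blast
qed

text \<open>Moving \<open>upper x\<close> past the diagonal matrix turns it into
  \<open>upper (b * b * x)\<close>, so the translate of \<open>w\<close> is an eigenvector with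
  parameter \<open>b * b * y\<close>. Orthogonality then decides whether its
  \<open>y\<close>-component survives.\<close>

lemma eigen_component_rho_diagonal:
  assumes ab: "[a * b = 1] (mod m)" and w: "w \<in> V"
    and eig: "\<And>x. \<rho> (upper x) w = scale (unit_char m (x * y)) w"
  shows "eigen_component y (\<rho> (mat a 0 0 b) w)
      = scale (if m dvd (b * b - 1) * y then of_int m else 0) (\<rho> (mat a 0 0 b) w)"
proof -
  have m: "m > 0"
    using m_gt_one by simp
  have t: "mat a 0 0 b \<in> carrier (SL2 R)"
    using ab by (simp add: mat_in_SL2_iff)
  have "\<rho> (upper x) (\<rho> (mat a 0 0 b) w) = scale (unit_char m (b * b * x * y)) (\<rho> (mat a 0 0 b) w)" for x
  proof -
    have "[x * b = (a * b) * (x * b)] (mod m)"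
      using cong_mult[OF ab cong_refl, of "x * b"] by (simp add: cong_sym)
    then have "upper x \<otimes>\<^bsub>SL2 R\<^esub> mat a 0 0 b = mat a 0 0 b \<otimes>\<^bsub>SL2 R\<^esub> upper (b * b * x)"
      by (simp add: mat_mult mat_eq_iff ac_simps)
    then have "\<rho> (upper x) (\<rho> (mat a 0 0 b) w) = \<rho> (mat a 0 0 b) (\<rho> (upper (b * b * x)) w)"
      using t w upper_in_SL2 by (simp add: rep.composition_rule[symmetric])
    then show ?thesis
      using t w by (simp add: eig rep.rho_scale)
  qed
  then have "eigen_component y (\<rho> (mat a 0 0 b) w)
      = (\<Sum>x\<in>{0..<m}. scale (unit_char m (x * ((b * b - 1) * y))) (\<rho> (mat a 0 0 b) w))"
    by (simp add: eigen_component_def unit_char_add[symmetric] algebra_simps)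
  then show ?thesis
    by (simp add: rep.scale_sum_left[symmetric] sum_unit_char[OF m])
qed

text \<open>The sum of the torus translates of \<open>w\<close> is fixed; only its vanishing has to
  be excluded. Translates with a different character have zero \<open>y\<close>-component, and the
  others equal \<open>w\<close> by \<open>stab\<close>, so nothing can cancel.\<close>

lemma torus_fixed_vector_if_stabilizer_trivial:
  assumes w: "w \<in> V" "w \<noteq> 0" and eig: "\<And>x. \<rho> (upper x) w = scale (unit_char m (x * y)) w"
    and stab: "\<And>a b. \<lbrakk>[a * b = 1] (mod m); m dvd (b * b - 1) * y\<rbrakk> \<Longrightarrow> \<rho> (mat a 0 0 b) w = w"
  obtains f where "f \<in> V" "f \<noteq> 0" "\<And>t. t \<in> torus \<Longrightarrow> \<rho> t f = f"
proof
  have m: "m > 0"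
    using m_gt_one by simp
  have sub: "torus \<subseteq> carrier (SL2 R)"
    using subgroup_torus by (rule subgroup.subset)
  have fin: "finite torus"
    using sub finite_SL2 by (rule finite_subset)
  let ?f = "\<Sum>t\<in>torus. \<rho> t w"
  show "?f \<in> V"
    using sub w by (intro rep.subspace_sum rep.subspace_V rep.rho_in_V) auto
  show "\<rho> t ?f = ?f" if "t \<in> torus" for t
    using rep.sum_over_subgroup_fixed[OF subgroup_torus that w(1)] .
  \<comment> \<open>The coefficient is \<open>m\<close> or 0; taking it real makes its sign
    available.\<close>
  have "\<exists>c::real. c \<ge> 0 \<and> eigen_component y (\<rho> t w) = scale (of_real c) w" if t: "t \<in> torus" for t
  proof -
    obtain a b where ab: "t = mat a 0 0 b" "[a * b = 1] (mod m)"
      using t by (auto simp: torus_def)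
    show ?thesis
    proof (cases "m dvd (b * b - 1) * y")
      case True
      then show ?thesis
        using eigen_component_rho_diagonal[OF ab(2) w(1) eig] stab[OF ab(2) True] m
        by (intro exI[of _ "of_int m"]) (simp add: ab)
    next
      case False
      then show ?thesis
        using eigen_component_rho_diagonal[OF ab(2) w(1) eig]
        by (intro exI[of _ 0]) (simp add: ab)
    qed
  qed
  then obtain c :: "_ \<Rightarrow> real" where c: "\<And>t. t \<in> torus \<Longrightarrow> c t \<ge> 0"
      "\<And>t. t \<in> torus \<Longrightarrow> eigen_component y (\<rho> t w) = scale (of_real (c t)) w"
    by metis
  have one: "\<one>\<^bsub>SL2 R\<^esub> \<in> torus"
    using subgroup_torus by (rule subgroup.one_closed)
  \<comment> \<open>The identity of the torus contributes the strictly positive coefficient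
    \<open>m\<close>.\<close>
  have "eigen_component y w = scale (of_int m) w"
    using eigen_component_rho_diagonal[of 1 1 w y] w(1) eig rep.rho_one[OF w(1)]
    by (simp add: one_SL2)
  then have "scale (of_real (c \<one>\<^bsub>SL2 R\<^esub>)) w = scale (of_int m) w"
    using c(2)[OF one] by (simp add: rep.rho_one w)
  then have "of_real (c \<one>\<^bsub>SL2 R\<^esub>) = (of_int m :: complex)"
    using w(2) by simp
  then have "c \<one>\<^bsub>SL2 R\<^esub> = of_int m"
    by (metis of_real_eq_iff of_real_of_int_eq)
  then have pos: "(\<Sum>t\<in>torus. c t) > 0"
    using one fin c(1) m by (intro sum_pos2[of _ "\<one>\<^bsub>SL2 R\<^esub>"]) auto
  have "eigen_component y ?f = (\<Sum>t\<in>torus. eigen_component y (\<rho> t w))"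
  proof -
    have "\<rho> (upper x) ?f = (\<Sum>t\<in>torus. \<rho> (upper x) (\<rho> t w))" for x
      using sub w by (intro rep.rho_sum upper_in_SL2 rep.rho_in_V) auto
    then show ?thesis
      unfolding eigen_component_def by (simp add: rep.scale_sum_right sum.swap[of _ torus])
  qed
  also have "\<dots> = scale (of_real (\<Sum>t\<in>torus. c t)) w"
    by (simp add: c(2) rep.scale_sum_left)
  finally have *: "eigen_component y ?f = scale (of_real (\<Sum>t\<in>torus. c t)) w" .
  show "?f \<noteq> 0"
  proof
    assume "?f = 0"
    then have "eigen_component y ?f = 0"
      by (simp add: eigen_component_def rep.rho_zero upper_in_SL2)
    then show False
      using * pos w(2) by (simp del: of_real_sum)
  qed
qed

end

section \<open>Prime power moduli and the torus-fixed vector\<close>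

text \<open>The conditions on \<open>p ^ M * y\<close> and \<open>p ^ (M - 1) * y\<close> say that
  the character with parameter \<open>y\<close> has exact order \<open>p ^ M\<close>, that is,
  \<open>y\<close> is \<open>p ^ (n - M)\<close> times an integer prime to \<open>p\<close>.
  Cancelling leaves \<open>p ^ M\<close> dividing \<open>(b - 1) * (b + 1)\<close>, and an odd prime
  divides at most one of two numbers differing by 2.\<close>

lemma prime_power_dvd_square_minus_one_mult:
  fixes p b y :: int
  assumes "prime p" "p > 2" "0 < M" "M \<le> n"
    and "p ^ n dvd p ^ M * y" "\<not> p ^ n dvd p ^ (M - 1) * y" "p ^ n dvd (b * b - 1) * y"
  shows "p ^ M dvd b - 1 \<or> p ^ M dvd b + 1"
proof -
  have p: "p \<noteq> 0"
    using \<open>p > 2\<close> by simp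
  have n: "p ^ n = p ^ M * p ^ (n - M)"
    using \<open>M \<le> n\<close> by (simp flip: power_add)
  then have "p ^ (n - M) dvd y"
    using assms(5) p by simp
  then obtain y' where y': "y = p ^ (n - M) * y'" ..
  have "\<not> p dvd y'"
  proof
    assume "p dvd y'"
    then have "p ^ (M - 1) * p ^ (n - M) * p dvd p ^ (M - 1) * p ^ (n - M) * y'"
      by (intro mult_dvd_mono dvd_refl)
    also have "p ^ (M - 1) * p ^ (n - M) * p = p ^ n"
      using \<open>0 < M\<close> n by (cases M) simp_all
    also have "p ^ (M - 1) * p ^ (n - M) * y' = p ^ (M - 1) * y"
      by (simp add: y' mult.assoc)
    finally show False
      using assms(6) by blast
  qed
  then have "coprime (p ^ M) y'"
    using \<open>prime p\<close> by (simp add: prime_imp_coprime)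
  moreover have "p ^ M dvd (b * b - 1) * y'"
    using assms(7) p by (simp add: n y' ac_simps)
  ultimately have "p ^ M dvd b * b - 1"
    by (simp only: coprime_dvd_mult_left_iff)
  then have dvd: "p ^ M dvd (b - 1) * (b + 1)"
    by (simp add: algebra_simps)
  show ?thesis
  proof (cases "p dvd b - 1")
    case True
    have "\<not> p dvd b + 1"
    proof
      assume "p dvd b + 1"
      then have "p dvd b + 1 - (b - 1)"
        using True by (rule dvd_diff)
      then show False
        using \<open>p > 2\<close> zdvd_imp_le[of p 2] by simp
    qed
    then have "coprime (p ^ M) (b + 1)"
      using \<open>prime p\<close> by (simp add: prime_imp_coprime)
    then show ?thesis
      using dvd by (simp add: coprime_dvd_mult_left_iff)
  next
    case False
    then have "coprime (p ^ M) (b - 1)"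
      using \<open>prime p\<close> by (simp add: prime_imp_coprime)
    then show ?thesis
      using dvd by (simp add: coprime_dvd_mult_right_iff)
  qed
qed

lemma (in residues_SL2_representation) torus_fixed_vector:
  fixes p :: int
  assumes p: "prime p" "p > 2" and mp: "m = p ^ n"
    and neg: "rep.acts_trivially (SL2_neg_id R)" and V: "V \<noteq> {0}"
  obtains f where "f \<in> V" "f \<noteq> 0" "\<And>t. t \<in> torus \<Longrightarrow> \<rho> t f = f"
proof -
  have m: "m > 0"
    using m_gt_one by simp
  define P where "P M \<longleftrightarrow> (\<forall>k. rep.acts_trivially (upper (k * p ^ M)))" for M
  define M where "M = (LEAST M. P M)"
  \<comment> \<open>\<open>p ^ n\<close> is zero modulo \<open>m\<close>, so the least exponent
    exists and is at most \<open>n\<close>.\<close>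
  have "upper (k * p ^ n) = \<one>\<^bsub>SL2 R\<^esub>" for k
    by (simp add: one_SL2 mat_eq_iff) (simp add: mp cong_0_iff)
  then have "P n"
    by (simp add: P_def rep.acts_trivially_def rep.rho_one)
  then have "P M" "M \<le> n"
    unfolding M_def by (auto intro: LeastI Least_le)
  then have diag: "rep.acts_trivially (mat a 0 0 b)" if "[a * b = 1] (mod m)" "p ^ M dvd a - 1" for a b
    using that diagonal_acts_trivially[of "p ^ M" a b] by (simp add: P_def)
  show thesis
  proof (cases "M = 0")
    case True
    \<comment> \<open>Here \<open>p ^ M = 1\<close>, so \<open>diag\<close> covers the whole torus
      and any nonzero vector will do.\<close>
    obtain f where "f \<in> V" "f \<noteq> 0"
      using V rep.subspace_0[OF rep.subspace_V] by blast
    moreover have "\<rho> t f = f" if "t \<in> torus" for t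
      using that diag \<open>f \<in> V\<close> True by (auto simp: torus_def rep.acts_trivially_def)
    ultimately show thesis
      by (rule that)
  next
    case False
    then have "\<not> P (M - 1)"
      unfolding M_def using not_less_Least[of "M - 1" P] by (simp add: M_def)
    then obtain k v where "v \<in> V" "\<rho> (upper (k * p ^ (M - 1))) v \<noteq> v"
      by (auto simp: P_def rep.acts_trivially_def)
    then obtain w y where w: "w \<in> V" "w \<noteq> 0"
      and eig: "\<And>a. \<rho> (upper a) w = scale (unit_char m (a * y)) w"
      and y: "\<not> m dvd k * p ^ (M - 1) * y"
      using exists_upper_eigenvector by metis
    \<comment> \<open>The choice of \<open>y\<close> keeps the order of its character from dividing
      \<open>p ^ (M - 1)\<close>; \<open>P M\<close> now makes it divide
      \<open>p ^ M\<close>.\<close>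
    have "rep.acts_trivially (upper (1 * p ^ M))"
      using \<open>P M\<close> unfolding P_def by blast
    then have "scale (unit_char m (p ^ M * y)) w = scale 1 w"
      using w(1) eig[of "p ^ M"] by (simp add: rep.acts_trivially_def)
    then have "m dvd p ^ M * y"
      using w(2) m by (simp only: rep.scale_cancel_right unit_char_eq_1_iff) simp
    have stab: "\<rho> (mat a 0 0 b) w = w" if ab: "[a * b = 1] (mod m)" and "m dvd (b * b - 1) * y" for a b
    proof -
      have "p ^ M dvd b - 1 \<or> p ^ M dvd b + 1"
        using that y \<open>m dvd p ^ M * y\<close> \<open>M \<le> n\<close> False p
        by (intro prime_power_dvd_square_minus_one_mult[of p M n y]) (auto simp: mp mult.assoc)
      moreover have dvd: "p ^ M dvd a * b - 1"
        using ab \<open>M \<le> n\<close> by (metis cong_iff_dvd_diff dvd_trans le_imp_power_dvd mp)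
      ultimately consider "p ^ M dvd a - 1" | "p ^ M dvd - a - 1"
      proof (elim disjE)
        assume "p ^ M dvd b - 1"
        then have "p ^ M dvd (a * b - 1) - a * (b - 1)"
          by (rule dvd_diff[OF dvd dvd_mult])
        then show thesis
          using that(1) by (simp add: algebra_simps)
      next
        assume "p ^ M dvd b + 1"
        then have "p ^ M dvd (a * b - 1) - a * (b + 1)"
          by (rule dvd_diff[OF dvd dvd_mult])
        also have "(a * b - 1) - a * (b + 1) = - a - 1"
          by (simp add: algebra_simps)
        finally show thesis
          by (rule that(2))
      qed
      then have "rep.acts_trivially (mat a 0 0 b)"
      proof cases
        case 1
        then show ?thesis
          using ab diag by blast
      next
        case 2
        \<comment> \<open>When \<open>a\<close> is -1 modulo \<open>p ^ M\<close>, split off the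
          negative identity; the remaining factor is covered by \<open>diag\<close>.\<close>
        then have "rep.acts_trivially (mat (- 1) 0 0 (- 1) \<otimes>\<^bsub>SL2 R\<^esub> mat (- a) 0 0 (- b))"
          using ab diag[of "- a" "- b"] neg
          by (intro rep.acts_trivially_mult) (simp_all add: SL2_neg_id mat_in_SL2_iff)
        then show ?thesis
          by (simp add: mat_mult)
      qed
      then show ?thesis
        using w(1) by (simp add: rep.acts_trivially_def)
    qed
    show thesis
      using torus_fixed_vector_if_stabilizer_trivial[OF w eig stab] that by blast
  qed
qed

theorem theorem23p5:
  fixes p n :: nat
    and scale :: "complex \<Rightarrow> 'v \<Rightarrow> 'v::ab_group_add"
    and V :: "'v set"
    and \<rho> :: "int \<times> int \<times> int \<times> int \<Rightarrow> 'v \<Rightarrow> 'v"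
  defines "R \<equiv> residue_ring (int (p ^ n))"
  assumes "prime p" and "p > 3" and "n > 0"
    and "irreducible_representation (SL2 R) scale V \<rho>"
  shows "occurs_in (SL2 R) scale V \<rho>
           fun_scale (functions_on (SL2 R)) (conj_action (SL2 R))
         \<longleftrightarrow> (\<forall>v\<in>V. \<rho> (SL2_neg_id R) v = v)"
proof -
  interpret irreducible_representation "SL2 R" scale V \<rho> by fact
  interpret R: residues "int (p ^ n)" R
    using \<open>p > 3\<close> \<open>n > 0\<close> one_less_power[of p n]
    by (intro residues.intro) (simp_all add: R_def del: of_nat_power)
  interpret residues_SL2_representation "int (p ^ n)" R scale V \<rho>
    by (intro residues_SL2_representation.intro R.residues_axioms
        group_representation_axioms[unfolded R_def]) (simp_all add: R_def)
  show ?thesis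
  proof
    assume occurs: "occurs_in (SL2 R) scale V \<rho>
      fun_scale (functions_on (SL2 R)) (conj_action (SL2 R))"
    have "SL2_neg_id R \<in> carrier (SL2 R)"
      unfolding R.SL2_neg_id by (rule R.mat_in_SL2) simp
    then show "\<forall>v\<in>V. \<rho> (SL2_neg_id R) v = v"
      using group.central_acts_trivially_if_occurs[OF R.group_SL2 group_representation_axioms occurs]
        R.neg_id_central by blast
  next
    assume neg: "\<forall>v\<in>V. \<rho> (SL2_neg_id R) v = v"
    obtain f where f: "f \<in> V" "f \<noteq> 0" "\<And>t. t \<in> R.torus \<Longrightarrow> \<rho> t f = f"
      using torus_fixed_vector[of "int p" n] \<open>prime p\<close> \<open>p > 3\<close> neg nonzero
      by (auto simp: acts_trivially_def)
    \<comment> \<open>Invertibility of 2 provides the entry \<open>e\<close>, the inverse of 2, in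
      \<open>R.mat 2 0 0 e\<close>; invertibility of 3 puts the centralizer of that matrix inside
      the torus.\<close>
    have "coprime (int p) 2" "coprime (int p) 3"
      using \<open>prime p\<close> \<open>p > 3\<close> by (auto intro!: primes_coprime simp del: coprime_right_2_iff_odd)
    then have coprime: "coprime 2 (int (p ^ n))" "coprime (int (p ^ n)) 3"
      by (simp_all add: coprime_commute)
    then obtain e where e: "[2 * e = 1] (mod int (p ^ n))"
      using coprime_iff_invertible_int[of 2 "int (p ^ n)"] by auto
    show "occurs_in (SL2 R) scale V \<rho> fun_scale (functions_on (SL2 R)) (conj_action (SL2 R))"
    proof (rule group.occurs_if_centralizer_fixes[OF R.group_SL2 _ R.finite_SL2 _ f(1,2)])
      show "irreducible_representation (SL2 R) scale V \<rho>" by fact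
      show "R.mat 2 0 0 e \<in> carrier (SL2 R)"
        unfolding R.mat_in_SL2_iff using e by simp
      show "\<rho> k f = f" if "k \<in> carrier (SL2 R)"
        "k \<otimes>\<^bsub>SL2 R\<^esub> R.mat 2 0 0 e = R.mat 2 0 0 e \<otimes>\<^bsub>SL2 R\<^esub> k" for k
        using R.centralizer_in_torus[OF coprime(2) e that] by (rule f(3))
    qed
  qed
qed

end
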